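(* Let $G$ be a finite simple graph, let $d\ge 0$ be an integer, and let $<$ be an arbitrary linear ordering of $V(G)$. Then $\operatorname{tww}(G)\le d$ if and only if there exists a twin-width decomposition $(T,\prec)$ of $G$ of width at most $d$ such that (1) whenever $x$ is the parent of $y$ in $T$, we have $y < x$; and (2) the root of $T$ is the $<$-maximal element of $V(G)$.
   Context: A trigraph is a graph whose edge set is partitioned into black edges and red edges; an ordinary graph is a trigraph with all edges black. $N_G(v)$ denotes the set of all (black or red) neighbours of $v$; the red degree of $v$ is its number of red neighbours; a $d$-trigraph is a trigraph in which every vertex has red degree at most $d$. Contracting two distinct (not necessarily adjacent) vertices $u,v$ of a trigraph means replacing them by a single new vertex $w$: every vertex of $N(u)\triangle N(v)$ (other than $u,v$) becomes a red neighbour of $w$; a vertex $x\in N(u)\cap N(v)$ becomes a black neighbour of $w$ if $xu$ and $xv$ are both black, and a red neighbour of $w$ otherwise; all edges not incident with $u$ or $v$ are unchanged. A $d$-sequence for an $n$-vertex graph $G$ is a sequence of $d$-trigraphs $G_0=G,G_1,\dots,G_{n-1}$ where each $G_i$ ($i\ge1$) is obtained from $G_{i-1}$ by one contraction and $G_{n-1}$ has a single vertex. The twin-width $\operatorname{tww}(G)$ is the least $d$ such that $G$ has a $d$-sequence. A twin-width decomposition of $G$ is a pair $(T,\prec)$ where $T$ is a rooted tree with $V(T)=V(G)$ (the contraction tree) and $\prec$ is a linear ordering of $V(G)$ (the elimination ordering) such that $u\prec v$ whenever $v$ is the parent of $u$ in $T$. Writing $V(G)=\{v_1,\dots,v_n\}$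 with $v_1\prec\dots\prec v_n$ (so $v_n$ is the root) and $p_i$ for the parent of $v_i$ in $T$ ($i<n$), define graphs $H_0,\dots,H_{n-1}$ with $V(H_i)=\{v_{i+1},\dots,v_n\}$, $E(H_0)=\emptyset$, and for $1\le i<n$, $E(H_i)$ is the union of: $\{uv\in E(H_{i-1}) : u,v\in V(H_i)\}$; $\{up_i : v_iu\in E(H_{i-1})\}$; $\{up_i : v_iu\in E(G),\ p_iu\notin E(G),\ u\in V(H_i)\}$; $\{up_i : v_iu\notin E(G),\ p_iu\in E(G),\ u\in V(H_i)\}$ (edges are unordered pairs of distinct vertices). This is the elimination sequence defined by $(T,\prec)$. The width of $(T,\prec)$ is the least $d$ such that every $H_i$ has maximum degree at most $d$. *)

theory Defs
  imports Main
begin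

definition vertex_pairs :: "'a set \<Rightarrow> 'a set set" where
  "vertex_pairs V = {{u, v} | u v. u \<in> V \<and> v \<in> V \<and> u \<noteq> v}"

record 'a graph =
  verts :: "'a set"
  edges :: "'a set set"

definition finite_simple_graph :: "'a graph \<Rightarrow> bool" where
  "finite_simple_graph G \<longleftrightarrow> finite (verts G) \<and> edges G \<subseteq> vertex_pairs (verts G)"

definition degree :: "'a graph \<Rightarrow> 'a \<Rightarrow> nat" where
  "degree G v = card {u \<in> verts G. {u, v} \<in> edges G}"

record 'a trigraph =
  tverts :: "'a set"
  black :: "'a set set"
  red :: "'a set set"

definition is_trigraph :: "'a trigraph \<Rightarrow> bool" where
  "is_trigraph G \<longleftrightarrow>
     finite (tverts G) \<and> black G \<union> red G \<subseteq> vertex_pairs (tverts G) \<and> black G \<inter> red G = {}"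

definition trigraph_of :: "'a graph \<Rightarrow> 'a trigraph" where
  "trigraph_of G = \<lparr>tverts = verts G, black = edges G, red = {}\<rparr>"

definition neighbours :: "'a trigraph \<Rightarrow> 'a \<Rightarrow> 'a set" where
  "neighbours G v = {u \<in> tverts G. {u, v} \<in> black G \<union> red G}"

definition red_degree :: "'a trigraph \<Rightarrow> 'a \<Rightarrow> nat" where
  "red_degree G v = card {u \<in> tverts G. {u, v} \<in> red G}"

definition d_trigraph :: "nat \<Rightarrow> 'a trigraph \<Rightarrow> bool" where
  "d_trigraph d G \<longleftrightarrow> is_trigraph G \<and> (\<forall>v\<in>tverts G. red_degree G v \<le> d)"

definition contract :: "'a trigraph \<Rightarrow> 'a \<Rightarrow> 'a \<Rightarrow> 'a \<Rightarrow> 'a trigraph" where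
  "contract G u v w =
     \<lparr>tverts = insert w (tverts G - {u, v}),
      black = {e \<in> black G. u \<notin> e \<and> v \<notin> e}
        \<union> {{x, w} | x. x \<in> neighbours G u \<inter> neighbours G v
                       \<and> {x, u} \<in> black G \<and> {x, v} \<in> black G},
      red = {e \<in> red G. u \<notin> e \<and> v \<notin> e}
        \<union> {{x, w} | x. x \<in> sym_diff (neighbours G u) (neighbours G v) - {u, v}}
        \<union> {{x, w} | x. x \<in> neighbours G u \<inter> neighbours G v
                       \<and> \<not> ({x, u} \<in> black G \<and> {x, v} \<in> black G)}\<rparr>"

text \<open>
  The new vertex \<open>w\<close> has to differ from all the vertices that remain. It may carry a name that the
  contraction has just freed (\<open>u\<close> or \<open>v\<close>): the vertex type may be finite, and then it need not contain
  a name outside the vertex set. The name of \<open>w\<close> only affects the result up to isomorphism.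
\<close>

definition contraction :: "'a trigraph \<Rightarrow> 'a trigraph \<Rightarrow> bool" where
  "contraction G G' \<longleftrightarrow>
     (\<exists>u\<in>tverts G. \<exists>v\<in>tverts G. \<exists>w. u \<noteq> v \<and> w \<notin> tverts G - {u, v} \<and> G' = contract G u v w)"

definition d_sequence :: "nat \<Rightarrow> 'a graph \<Rightarrow> (nat \<Rightarrow> 'a trigraph) \<Rightarrow> bool" where
  "d_sequence d G S \<longleftrightarrow>
     S 0 = trigraph_of G
     \<and> (\<forall>i < card (verts G). d_trigraph d (S i))
     \<and> (\<forall>i \<in> {1..<card (verts G)}. contraction (S (i - 1)) (S i))
     \<and> card (tverts (S (card (verts G) - 1))) = 1"

definition tww :: "'a graph \<Rightarrow> nat" where
  "tww G = (LEAST d. \<exists>S. d_sequence d G S)"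

text \<open>
  A rooted tree is given by its vertex set, its root and the parent of every other vertex; the value
  of \<open>parent\<close> at the root and outside the vertex set plays no role.
\<close>

record 'a rtree =
  nodes :: "'a set"
  root :: 'a
  parent :: "'a \<Rightarrow> 'a"

definition is_parent :: "'a rtree \<Rightarrow> 'a \<Rightarrow> 'a \<Rightarrow> bool" where
  "is_parent T x y \<longleftrightarrow> y \<in> nodes T - {root T} \<and> x = parent T y"

definition rooted_tree :: "'a rtree \<Rightarrow> bool" where
  "rooted_tree T \<longleftrightarrow>
     root T \<in> nodes T
     \<and> (\<forall>y \<in> nodes T - {root T}. parent T y \<in> nodes T)
     \<and> (\<forall>y \<in> nodes T. (y, root T) \<in> {(z, x). is_parent T x z}\<^sup>*)"

definition linear_ordering_of :: "'a set \<Rightarrow> 'a rel \<Rightarrow> bool" where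
  "linear_ordering_of V R \<longleftrightarrow> R \<subseteq> V \<times> V \<and> strict_linear_order_on V R"

definition tww_decomposition :: "'a graph \<Rightarrow> 'a rtree \<Rightarrow> 'a rel \<Rightarrow> bool" where
  "tww_decomposition G T prec \<longleftrightarrow>
     rooted_tree T \<and> nodes T = verts G \<and> linear_ordering_of (verts G) prec
     \<and> (\<forall>u v. is_parent T v u \<longrightarrow> (u, v) \<in> prec)"

text \<open>
  \<open>nth_vertex V prec i\<close> is the vertex \<open>v\<^sub>i\<close> in the increasing enumeration of \<open>V\<close>, counted from 1.
\<close>

definition nth_vertex :: "'a set \<Rightarrow> 'a rel \<Rightarrow> nat \<Rightarrow> 'a" where
  "nth_vertex V prec i = (THE v. v \<in> V \<and> card {u \<in> V. (u, v) \<in> prec} + 1 = i)"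

definition later_vertices :: "'a set \<Rightarrow> 'a rel \<Rightarrow> nat \<Rightarrow> 'a set" where
  "later_vertices V prec i = nth_vertex V prec ` {i + 1..card V}"

primrec elimination_graph :: "'a graph \<Rightarrow> 'a rtree \<Rightarrow> 'a rel \<Rightarrow> nat \<Rightarrow> 'a graph" where
  "elimination_graph G T prec 0 = \<lparr>verts = later_vertices (verts G) prec 0, edges = {}\<rparr>"
| "elimination_graph G T prec (Suc j) =
     (let i = Suc j;
          H = elimination_graph G T prec j;
          W = later_vertices (verts G) prec i;
          v = nth_vertex (verts G) prec i;
          p = parent T v
      in \<lparr>verts = W,
          edges = {e \<in> edges H. e \<subseteq> W}
            \<union> {{u, p} | u. {v, u} \<in> edges H \<and> u \<noteq> p}
            \<union> {{u, p} | u. {v, u} \<in> edges G \<and> {p, u} \<notin> edges G \<and> u \<in> W \<and> u \<noteq> p}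
            \<union> {{u, p} | u. {v, u} \<notin> edges G \<and> {p, u} \<in> edges G \<and> u \<in> W \<and> u \<noteq> p}\<rparr>)"

definition decomposition_width :: "'a graph \<Rightarrow> 'a rtree \<Rightarrow> 'a rel \<Rightarrow> nat" where
  "decomposition_width G T prec =
     (LEAST d. \<forall>i < card (verts G). \<forall>x \<in> verts (elimination_graph G T prec i).
                 degree (elimination_graph G T prec i) x \<le> d)"

end

theory Submission
  imports Defs
begin

text \<open>
  A vertex of a contracted trigraph stands for a set of original vertices. Represent each such part
  by its maximal element in the given ordering. Merging two parts then eliminates the smaller
  representative, and the larger one serves as its parent; the root, surviving to the end, is the
  overall maximum. In terms of the representatives, one contraction changes the red edges exactly
  as one step of the elimination sequence does, because a pair of parts without a red edge is
  homogeneous and hence its adjacency is that of the representatives in the original graph.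
  Conversely, a decomposition dictates a sequence of contractions in which the merged vertex keeps
  the name of the parent.
\<close>

section \<open>Edges as two-element sets\<close>

lemma doubleton_mem_vertex_pairs: "{x, y} \<in> vertex_pairs V \<longleftrightarrow> x \<in> V \<and> y \<in> V \<and> x \<noteq> y"
  unfolding vertex_pairs_def by (auto simp: doubleton_eq_iff)

lemma vertex_pairs_subset: "e \<in> vertex_pairs V \<Longrightarrow> e \<subseteq> W \<Longrightarrow> e \<in> vertex_pairs W"
  unfolding vertex_pairs_def by auto

subsection \<open>Contractions in terms of representatives\<close>

text \<open>One update from \<open>H_{i-1}\<close> to \<open>H_i\<close>, split off from
  \<open>elimination_graph\<close> so that it also applies to edge sets read off from trigraphs.
  \<open>E\<close> holds the edges of the original graph, \<open>W\<close> the surviving vertices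
  and \<open>R\<close> the old edges; \<open>v\<close> is eliminated into \<open>p\<close>.\<close>

definition merge_red :: "'a set set \<Rightarrow> 'a set \<Rightarrow> 'a set set \<Rightarrow> 'a \<Rightarrow> 'a \<Rightarrow> 'a set set" where
  "merge_red E W R v p = {e \<in> R. e \<subseteq> W}
            \<union> {{u, p} | u. {v, u} \<in> R \<and> u \<noteq> p}
            \<union> {{u, p} | u. {v, u} \<in> E \<and> {p, u} \<notin> E \<and> u \<in> W \<and> u \<noteq> p}
            \<union> {{u, p} | u. {v, u} \<notin> E \<and> {p, u} \<in> E \<and> u \<in> W \<and> u \<noteq> p}"

lemma merge_red_subset:
  assumes "R \<subseteq> vertex_pairs U" "p \<in> U" "p \<noteq> v"
  shows "merge_red E (U - {v}) R v p \<subseteq> vertex_pairs (U - {v})"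
proof
  fix e assume "e \<in> merge_red E (U - {v}) R v p"
  moreover have "u \<in> U - {v}" if "{v, u} \<in> R" for u
    using assms(1) that doubleton_mem_vertex_pairs[of v u U] by auto
  ultimately consider "e \<in> R" "e \<subseteq> U - {v}" | u where "e = {u, p}" "u \<in> U - {v}" "u \<noteq> p"
    unfolding merge_red_def by blast
  then show "e \<in> vertex_pairs (U - {v})"
  proof cases
    case 1
    then show ?thesis using assms(1) vertex_pairs_subset by blast
  next
    case 2
    then show ?thesis using assms(2,3) by (simp add: doubleton_mem_vertex_pairs)
  qed
qed

lemma merge_red_other:
  assumes "x \<in> W" "y \<in> W" "x \<noteq> p" "y \<noteq> p"
  shows "{x, y} \<in> merge_red E W R v p \<longleftrightarrow> {x, y} \<in> R"
  using assms unfolding merge_red_def by (auto simp: doubleton_eq_iff)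

text \<open>The last two sets of \<open>merge_red\<close> together say that \<open>v\<close> and
  \<open>p\<close> disagree about \<open>x\<close> in the original graph. This brings the update
  into the shape of the red clause of \<open>contract_new\<close>.\<close>

lemma merge_red_parent:
  assumes "x \<in> W" "p \<in> W" "x \<noteq> p"
  shows "{x, p} \<in> merge_red E W R v p \<longleftrightarrow>
    {x, v} \<in> R \<or> {x, p} \<in> R \<or> ({x, v} \<in> E) \<noteq> ({x, p} \<in> E)"
  using assms unfolding merge_red_def by (auto simp: doubleton_eq_iff insert_commute)

text \<open>Allows either vertex of a contracted pair to play the eliminated one.\<close>

lemma contract_commute: "contract S u v w = contract S v u w"
  unfolding contract_def by (auto simp: insert_commute)

section \<open>Adjacency after a single contraction\<close>

context
  fixes S :: "'a trigraph" and u v w :: 'a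
  assumes S: "is_trigraph S" and uv: "u \<in> tverts S" "v \<in> tverts S" "u \<noteq> v"
    and w: "w \<notin> tverts S - {u, v}"
begin

lemma edge_endpoints:
  assumes "{x, y} \<in> black S \<union> red S"
  shows "x \<in> tverts S \<and> y \<in> tverts S \<and> x \<noteq> y"
  using assms S unfolding is_trigraph_def using doubleton_mem_vertex_pairs[of x y "tverts S"] by blast

lemma black_red_disjoint: "e \<in> black S \<Longrightarrow> e \<notin> red S"
  using S unfolding is_trigraph_def by blast

lemma neighbours_iff: "x \<in> neighbours S y \<longleftrightarrow> {x, y} \<in> black S \<union> red S"
  using edge_endpoints unfolding neighbours_def by blast

lemma tverts_contract: "tverts (contract S u v w) = insert w (tverts S - {u, v})"
  unfolding contract_def by simp

lemma contract_other:
  assumes "x \<in> tverts S - {u, v}" "y \<in> tverts S - {u, v}"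
  shows "{x, y} \<in> red (contract S u v w) \<longleftrightarrow> {x, y} \<in> red S"
    and "{x, y} \<in> black (contract S u v w) \<longleftrightarrow> {x, y} \<in> black S"
  using assms w unfolding contract_def by (auto simp: doubleton_eq_iff)

text \<open>Since black and red are disjoint, the symmetric difference and the common neighbours
  with a red edge combine into one condition on the edges to \<open>u\<close> and
  \<open>v\<close>.\<close>

lemma contract_new:
  assumes x: "x \<in> tverts S - {u, v}"
  shows "{x, w} \<in> red (contract S u v w) \<longleftrightarrow>
      {x, u} \<in> red S \<or> {x, v} \<in> red S \<or> ({x, u} \<in> black S) \<noteq> ({x, v} \<in> black S)" (is ?red)
    and "{x, w} \<in> black (contract S u v w) \<longleftrightarrow> {x, u} \<in> black S \<and> {x, v} \<in> black S" (is ?black)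
proof -
  \<comment> \<open>The name \<open>w\<close> is either fresh or one of \<open>u\<close>,
    \<open>v\<close>, so no edge that survives unchanged can end in \<open>w\<close>.\<close>
  have old: "\<not> ({x, w} \<in> black S \<union> red S \<and> u \<notin> {x, w} \<and> v \<notin> {x, w})"
    using edge_endpoints[of x w] w by blast
  have eq: "{x, w} = {y, w} \<longleftrightarrow> x = y" for y
    by (auto simp: doubleton_eq_iff)
  show ?red
    using old x black_red_disjoint unfolding contract_def
    by (auto simp: eq neighbours_iff)
  show ?black
    using old x unfolding contract_def
    by (auto simp: eq neighbours_iff)
qed

text \<open>Every edge of the contraction lies among the untouched vertices or joins one of them to
  \<open>w\<close>. In both cases the characterisations of red and black above exclude each
  other.\<close>

lemma is_trigraph_contract: "is_trigraph (contract S u v w)"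
proof -
  let ?C = "contract S u v w" and ?V = "tverts S - {u, v}"
  have nb: "x \<in> ?V" if "x \<in> neighbours S u \<inter> neighbours S v \<or>
      x \<in> sym_diff (neighbours S u) (neighbours S v) - {u, v}" for x
    using that edge_endpoints[of x u] edge_endpoints[of x v] by (auto simp: neighbours_iff)
  have new: "{x, w} \<in> vertex_pairs (insert w ?V)" if "x \<in> ?V" for x
    using that w by (auto simp: doubleton_mem_vertex_pairs)
  have old: "e \<in> vertex_pairs ?V" if "e \<in> black S \<union> red S" "u \<notin> e" "v \<notin> e" for e
  proof -
    have "e \<in> vertex_pairs (tverts S)"
      using that S unfolding is_trigraph_def by blast
    moreover from this have "e \<subseteq> ?V"
      using that unfolding vertex_pairs_def by auto
    ultimately show ?thesis
      by (rule vertex_pairs_subset)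
  qed
  have cases: "e \<in> vertex_pairs ?V \<or> (\<exists>x\<in>?V. e = {x, w})" if "e \<in> black ?C \<union> red ?C" for e
  proof (cases "e \<in> black S \<union> red S \<and> u \<notin> e \<and> v \<notin> e")
    case True
    then show ?thesis using old by blast
  next
    case False
    then obtain x where "e = {x, w}" "x \<in> neighbours S u \<inter> neighbours S v \<or>
      x \<in> sym_diff (neighbours S u) (neighbours S v) - {u, v}"
      using \<open>e \<in> black ?C \<union> red ?C\<close> unfolding contract_def by auto
    then show ?thesis using nb by blast
  qed
  have "black ?C \<union> red ?C \<subseteq> vertex_pairs (insert w ?V)"
    using cases new unfolding vertex_pairs_def by blast
  moreover have "e \<notin> red ?C" if e: "e \<in> black ?C" for e
  proof -
    consider x y where "e = {x, y}" "x \<in> ?V" "y \<in> ?V" | x where "e = {x, w}" "x \<in> ?V"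
      using cases[of e] e unfolding vertex_pairs_def by blast
    then show ?thesis
    proof cases
      case 1
      then show ?thesis using e black_red_disjoint contract_other by blast
    next
      case 2
      then show ?thesis using e black_red_disjoint contract_new by blast
    qed
  qed
  moreover have "finite (tverts S)"
    using S unfolding is_trigraph_def by blast
  ultimately show ?thesis
    unfolding is_trigraph_def tverts_contract by blast
qed

end

text \<open>
  \<open>f\<close> sends every vertex of \<open>S\<close>, thought of as a part of the vertex set of the original graph, to a
  representative in that part. A part pair that is not red is homogeneous, so its colour can be
  read off from the edges \<open>E\<close> of the original graph at the two representatives.
\<close>

definition represents ::
    "'a set set \<Rightarrow> 'b trigraph \<Rightarrow> ('b \<Rightarrow> 'a) \<Rightarrow> 'a set \<Rightarrow> 'a set set \<Rightarrow> bool" where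
  "represents E S f U R \<longleftrightarrow> is_trigraph S \<and> bij_betw f (tverts S) U \<and> R \<subseteq> vertex_pairs U
    \<and> (\<forall>x\<in>tverts S. \<forall>y\<in>tverts S. x \<noteq> y \<longrightarrow>
        ({x, y} \<in> red S \<longleftrightarrow> {f x, f y} \<in> R) \<and> ({x, y} \<in> black S \<longleftrightarrow> {f x, f y} \<in> E - R))"

text \<open>The merged part inherits the representative \<open>f v\<close>, and \<open>f u\<close>
  is eliminated. If neither \<open>{f x, f u}\<close> nor \<open>{f x, f v}\<close> lies in
  \<open>R\<close>, then \<open>E - R\<close> and \<open>E\<close> agree on both, so the conditions
  of \<open>contract_new\<close> and \<open>merge_red_parent\<close> coincide; if one of them lies
  in \<open>R\<close>, both sides give red.\<close>

lemma represents_contract: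
  assumes rep: "represents E S f U R" and uv: "u \<in> tverts S" "v \<in> tverts S" "u \<noteq> v"
    and w: "w \<notin> tverts S - {u, v}"
  shows "represents E (contract S u v w) (f(w := f v)) (U - {f u})
    (merge_red E (U - {f u}) R (f u) (f v))"
proof -
  let ?C = "contract S u v w" and ?g = "f(w := f v)" and ?W = "U - {f u}"
  let ?R = "merge_red E ?W R (f u) (f v)" and ?V = "tverts S - {u, v}"
  have S: "is_trigraph S" and f: "bij_betw f (tverts S) U" and R: "R \<subseteq> vertex_pairs U"
    and iso: "\<And>x y. \<lbrakk>x \<in> tverts S; y \<in> tverts S; x \<noteq> y\<rbrakk> \<Longrightarrow>
        ({x, y} \<in> red S \<longleftrightarrow> {f x, f y} \<in> R) \<and> ({x, y} \<in> black S \<longleftrightarrow> {f x, f y} \<in> E - R)"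
    using rep unfolding represents_def by blast+
  note inj = bij_betw_imp_inj_on[OF f]
  note ctx = S uv w
  have g: "?g x = f x" if "x \<in> ?V" for x
    using that w by auto
  have fW: "f x \<in> ?W" "f x \<noteq> f v" if "x \<in> ?V" for x
    using that inj uv bij_betwE[OF f] by (auto dest: inj_onD)
  have fv: "f v \<in> ?W" "f v \<noteq> f u"
    using inj uv bij_betwE[OF f] by (auto dest: inj_onD)
  have "f ` ?V = ?W - {f v}"
    using inj_on_image_set_diff[OF inj, of "tverts S" "{u, v}"] uv f unfolding bij_betw_def by auto
  then have "bij_betw f ?V (?W - {f v})"
    using inj unfolding bij_betw_def by (auto intro: inj_on_subset)
  then have "bij_betw ?g ?V (?W - {f v})"
    using bij_betw_cong[of ?V ?g f] g by blast
  then have "bij_betw ?g (?V \<union> {w}) ((?W - {f v}) \<union> {f v})"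
    by (intro bij_betw_combine) (auto simp: bij_betw_def)
  moreover have "(?W - {f v}) \<union> {f v} = ?W"
    using fv by auto
  ultimately have bij: "bij_betw ?g (tverts ?C) ?W"
    unfolding tverts_contract[OF ctx] by simp
  have old: "({x, y} \<in> red ?C \<longleftrightarrow> {?g x, ?g y} \<in> ?R) \<and>
      ({x, y} \<in> black ?C \<longleftrightarrow> {?g x, ?g y} \<in> E - ?R)"
    if "x \<in> ?V" "y \<in> ?V" "x \<noteq> y" for x y
    using contract_other[OF ctx that(1,2)] iso[of x y] that g[of x] g[of y]
      merge_red_other[OF fW(1)[OF that(1)] fW(1)[OF that(2)] fW(2)[OF that(1)] fW(2)[OF that(2)]]
    by auto
  have new: "({x, w} \<in> red ?C \<longleftrightarrow> {?g x, ?g w} \<in> ?R) \<and>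
      ({x, w} \<in> black ?C \<longleftrightarrow> {?g x, ?g w} \<in> E - ?R)"
    if "x \<in> ?V" for x
    using contract_new[OF ctx that] iso[of x u] iso[of x v] uv that g[OF that]
      merge_red_parent[OF fW(1)[OF that] fv(1) fW(2)[OF that]]
    by auto
  have "({x, y} \<in> red ?C \<longleftrightarrow> {?g x, ?g y} \<in> ?R) \<and>
      ({x, y} \<in> black ?C \<longleftrightarrow> {?g x, ?g y} \<in> E - ?R)"
    if xy: "x \<in> tverts ?C" "y \<in> tverts ?C" "x \<noteq> y" for x y
  proof -
    consider "x \<in> ?V" "y \<in> ?V" | "x \<in> ?V" "y = w" | "x = w" "y \<in> ?V"
      using xy unfolding tverts_contract[OF ctx] by blast
    then show ?thesis
    proof cases
      case 1
      then show ?thesis using old xy by blast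
    next
      case 2
      then show ?thesis using new by blast
    next
      case 3
      then show ?thesis using new[of y] by (simp only: insert_commute)
    qed
  qed
  moreover have "?R \<subseteq> vertex_pairs ?W"
    using merge_red_subset[OF R, of "f v" "f u" E] fv by blast
  ultimately show ?thesis
    unfolding represents_def using is_trigraph_contract[OF ctx] bij by blast
qed

section \<open>Transfer of degree bounds to the representatives\<close>

lemma represents_red_degree:
  assumes "represents E S f U R" "x \<in> tverts S"
  shows "degree \<lparr>verts = U, edges = R\<rparr> (f x) = red_degree S x"
proof -
  have S: "is_trigraph S" and f: "bij_betw f (tverts S) U" and R: "R \<subseteq> vertex_pairs U"
    and iso: "\<And>y. \<lbrakk>y \<in> tverts S; y \<noteq> x\<rbrakk> \<Longrightarrow> {y, x} \<in> red S \<longleftrightarrow> {f y, f x} \<in> R"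
    using assms unfolding represents_def by blast+
  \<comment> \<open>\<open>represents\<close> compares distinct vertices only, whereas both degree
    counts range over all vertices; hence the diagonal is treated separately.\<close>
  have "{x, x} \<notin> red S" "{f x, f x} \<notin> R"
    using S R doubleton_mem_vertex_pairs[of x x] doubleton_mem_vertex_pairs[of "f x" "f x"]
    unfolding is_trigraph_def by blast+
  then have "{y, x} \<in> red S \<longleftrightarrow> {f y, f x} \<in> R" if "y \<in> tverts S" for y
    using iso that by (cases "y = x") auto
  then have "{y \<in> U. {y, f x} \<in> R} = f ` {y \<in> tverts S. {y, x} \<in> red S}"
    using f unfolding bij_betw_def by blast
  moreover have "inj_on f {y \<in> tverts S. {y, x} \<in> red S}"
    using f unfolding bij_betw_def by (auto intro: inj_on_subset)
  ultimately show ?thesis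
    unfolding degree_def red_degree_def by (simp add: card_image)
qed

lemma represents_d_trigraph:
  assumes "represents E S f U R"
  shows "d_trigraph d S \<longleftrightarrow> (\<forall>x\<in>U. degree \<lparr>verts = U, edges = R\<rparr> x \<le> d)"
proof -
  have "U = f ` tverts S" "is_trigraph S"
    using assms unfolding represents_def bij_betw_def by blast+
  then show ?thesis
    using represents_red_degree[OF assms] unfolding d_trigraph_def by auto
qed

lemma represents_trigraph_of:
  assumes "finite_simple_graph G"
  shows "represents (edges G) (trigraph_of G) id (verts G) {}"
  using assms unfolding represents_def trigraph_of_def is_trigraph_def finite_simple_graph_def by auto

subsection \<open>Enumerations of linear orders\<close>

definition enumerates :: "(nat \<Rightarrow> 'a) \<Rightarrow> 'a set \<Rightarrow> 'a rel \<Rightarrow> bool" where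
  "enumerates v V prec \<longleftrightarrow> bij_betw v {1..card V} V
    \<and> (\<forall>i\<in>{1..card V}. \<forall>j\<in>{1..card V}. (v i, v j) \<in> prec \<longleftrightarrow> i < j)"

text \<open>The predecessors of \<open>v j\<close> are exactly the values of \<open>v\<close> on
  \<open>{1..<j}\<close>, so its rank is \<open>j\<close>. Rank therefore determines the position,
  which gives the uniqueness needed for \<open>THE\<close>.\<close>

lemma nth_vertex_enumerates:
  assumes v: "enumerates v V prec" and i: "i \<in> {1..card V}"
  shows "nth_vertex V prec i = v i"
proof -
  have bij: "bij_betw v {1..card V} V"
    and mono: "\<And>i j. i \<in> {1..card V} \<Longrightarrow> j \<in> {1..card V} \<Longrightarrow> (v i, v j) \<in> prec \<longleftrightarrow> i < j"
    using v unfolding enumerates_def by blast+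
  have rank: "card {u \<in> V. (u, v j) \<in> prec} + 1 = j" if j: "j \<in> {1..card V}" for j
  proof -
    have "{u \<in> V. (u, v j) \<in> prec} = v ` {1..<j}"
    proof (intro equalityI subsetI)
      fix u assume u: "u \<in> {u \<in> V. (u, v j) \<in> prec}"
      then obtain k where k: "k \<in> {1..card V}" "u = v k"
        using bij unfolding bij_betw_def by blast
      then have "k < j" using mono u j by blast
      then show "u \<in> v ` {1..<j}" using k by auto
    next
      fix u assume "u \<in> v ` {1..<j}"
      then obtain k where k: "k \<in> {1..<j}" "u = v k" by blast
      then have "k \<in> {1..card V}" using j by auto
      then show "u \<in> {u \<in> V. (u, v j) \<in> prec}"
        using k mono[of k j] j bij bij_betwE by fastforce
    qed
    moreover have "inj_on v {1..<j}"
      using bij j unfolding bij_betw_def by (auto intro: inj_on_subset)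
    ultimately show ?thesis using j by (simp add: card_image)
  qed
  show ?thesis
    unfolding nth_vertex_def
  proof (rule the_equality)
    show "v i \<in> V \<and> card {u \<in> V. (u, v i) \<in> prec} + 1 = i"
      using rank[OF i] i bij bij_betwE by fastforce
    fix x assume x: "x \<in> V \<and> card {u \<in> V. (u, x) \<in> prec} + 1 = i"
    then obtain j where "j \<in> {1..card V}" "x = v j"
      using bij unfolding bij_betw_def by blast
    then show "x = v i" using rank x by auto
  qed
qed

lemma later_vertices_enumerates:
  assumes "enumerates v V prec"
  shows "later_vertices V prec i = v ` {i + 1..card V}"
  unfolding later_vertices_def using nth_vertex_enumerates[OF assms] by (intro image_cong) auto

lemma later_vertices_Suc:
  assumes v: "enumerates v V prec" and i: "i < card V"
  shows "later_vertices V prec (Suc i) = later_vertices V prec i - {v (Suc i)}"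
proof -
  have "inj_on v {1..card V}"
    using v unfolding enumerates_def bij_betw_def by blast
  moreover have "{i + 1..card V} = insert (Suc i) {Suc i + 1..card V}"
    using i by auto
  moreover have "v (Suc i) \<notin> v ` {Suc i + 1..card V}"
    using inj_onD[OF \<open>inj_on v {1..card V}\<close>, of "Suc i"] i by fastforce
  ultimately show ?thesis
    unfolding later_vertices_enumerates[OF v] by auto
qed

text \<open>The rank, one more than the number of predecessors, is strictly increasing, hence
  injective into \<open>{1..card V}\<close>, hence onto by counting. Its inverse is the
  enumeration.\<close>

lemma obtain_enumerates:
  assumes fin: "finite V" and lin: "linear_ordering_of V prec"
  obtains v where "enumerates v V prec"
proof -
  define rank where "rank x = card {u \<in> V. (u, x) \<in> prec} + 1" for x
  have "trans prec" "irrefl prec" "total_on V prec"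
    using lin unfolding linear_ordering_of_def strict_linear_order_on_def by auto
  have mono: "rank x < rank y" if "x \<in> V" "(x, y) \<in> prec" for x y
  proof -
    have "{u \<in> V. (u, x) \<in> prec} \<subset> {u \<in> V. (u, y) \<in> prec}"
      using that \<open>trans prec\<close> \<open>irrefl prec\<close> unfolding irrefl_def by (auto dest: transD)
    then show ?thesis
      unfolding rank_def using fin by (simp add: psubset_card_mono)
  qed
  have total: "(x, y) \<in> prec \<or> (y, x) \<in> prec" if "x \<in> V" "y \<in> V" "x \<noteq> y" for x y
    using that \<open>total_on V prec\<close> unfolding total_on_def by blast
  have "inj_on rank V"
    by (rule inj_onI) (metis mono total less_irrefl)
  moreover have "rank ` V \<subseteq> {1..card V}"
  proof -
    have "rank x \<le> card V" if "x \<in> V" for x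
    proof -
      have "{u \<in> V. (u, x) \<in> prec} \<subset> V"
        using that \<open>irrefl prec\<close> unfolding irrefl_def by auto
      then have "card {u \<in> V. (u, x) \<in> prec} < card V"
        using fin by (simp add: psubset_card_mono)
      then show ?thesis unfolding rank_def by simp
    qed
    moreover have "1 \<le> rank x" for x unfolding rank_def by simp
    ultimately show ?thesis by auto
  qed
  ultimately have bij: "bij_betw rank V {1..card V}"
    unfolding bij_betw_def by (simp add: card_image card_subset_eq)
  define v where "v = inv_into V rank"
  have v: "bij_betw v {1..card V} V"
    unfolding v_def using bij by (rule bij_betw_inv_into)
  have rv: "rank (v i) = i" if "i \<in> {1..card V}" for i
    unfolding v_def using bij that by (rule bij_betw_inv_into_right)
  have "(v i, v j) \<in> prec \<longleftrightarrow> i < j" if ij: "i \<in> {1..card V}" "j \<in> {1..card V}" for i j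
  proof -
    have V: "v i \<in> V" "v j \<in> V" using v ij bij_betwE by blast+
    show ?thesis
      using mono[of "v i" "v j"] mono[of "v j" "v i"] total[of "v i" "v j"] V rv ij
      by (metis less_asym' less_irrefl)
  qed
  then show ?thesis using that v unfolding enumerates_def by blast
qed

lemma enumerates_linear_ordering:
  assumes bij: "bij_betw v {1..card V} V"
  defines "prec \<equiv> {(v i, v j) | i j. i \<in> {1..card V} \<and> j \<in> {1..card V} \<and> i < j}"
  shows "enumerates v V prec" "linear_ordering_of V prec"
proof -
  have inj: "v i = v j \<longleftrightarrow> i = j" if "i \<in> {1..card V}" "j \<in> {1..card V}" for i j
    using bij that unfolding bij_betw_def by (auto dest: inj_onD)
  show en: "enumerates v V prec"
    unfolding enumerates_def prec_def using bij inj by blast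
  have mem: "x \<in> V \<longleftrightarrow> (\<exists>i\<in>{1..card V}. x = v i)" for x
    using bij unfolding bij_betw_def by blast
  have "prec \<subseteq> V \<times> V" unfolding prec_def using mem by blast
  moreover have "trans prec"
  proof (rule transI)
    fix x y z assume "(x, y) \<in> prec" "(y, z) \<in> prec"
    then obtain i j k l where "x = v i" "y = v j" "y = v k" "z = v l" "i < j" "k < l"
      "i \<in> {1..card V}" "j \<in> {1..card V}" "k \<in> {1..card V}" "l \<in> {1..card V}"
      unfolding prec_def by blast
    moreover from this have "j = k" using inj by blast
    ultimately show "(x, z) \<in> prec" unfolding prec_def
      by (intro CollectI exI[of _ i] exI[of _ l]) auto
  qed
  moreover have "irrefl prec" unfolding irrefl_def prec_def using inj by auto
  moreover have "total_on V prec"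
  proof (rule total_onI)
    fix x y assume "x \<in> V" "y \<in> V" "x \<noteq> y"
    then obtain i j where "i \<in> {1..card V}" "j \<in> {1..card V}" "x = v i" "y = v j" "i \<noteq> j"
      using mem by blast
    then show "(x, y) \<in> prec \<or> (y, x) \<in> prec"
      unfolding prec_def using linorder_neqE_nat[of i j] by blast
  qed
  ultimately show "linear_ordering_of V prec"
    unfolding linear_ordering_of_def strict_linear_order_on_def by blast
qed

subsection \<open>From decompositions to contraction sequences\<close>

lemma verts_elimination_graph:
  "verts (elimination_graph G T prec i) = later_vertices (verts G) prec i"
  by (cases i) (simp_all add: Let_def)

lemma edges_elimination_graph_Suc:
  "edges (elimination_graph G T prec (Suc i)) =
    merge_red (edges G) (later_vertices (verts G) prec (Suc i)) (edges (elimination_graph G T prec i))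
      (nth_vertex (verts G) prec (Suc i)) (parent T (nth_vertex (verts G) prec (Suc i)))"
  by (simp add: Let_def merge_red_def)

lemma decomposition_widthI:
  assumes "\<forall>i < card (verts G). \<forall>x \<in> verts (elimination_graph G T prec i).
                 degree (elimination_graph G T prec i) x \<le> d"
  shows "decomposition_width G T prec \<le> d"
  unfolding decomposition_width_def using assms by (rule Least_le)

text \<open>\<open>LEAST\<close> is meaningful only if some bound exists; the number of vertices of
  \<open>G\<close> is one.\<close>

lemma degree_le_decomposition_width:
  assumes i: "i < card (verts G)" and x: "x \<in> verts (elimination_graph G T prec i)"
  shows "degree (elimination_graph G T prec i) x \<le> decomposition_width G T prec"
proof -
  let ?H = "elimination_graph G T prec"
  have "degree (?H i) x \<le> card (verts G)" for i x
  proof -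
    have "degree (?H i) x \<le> card (verts (?H i))"
      unfolding degree_def
      by (rule card_mono) (auto simp: verts_elimination_graph later_vertices_def)
    also have "\<dots> \<le> card {i + 1..card (verts G)}"
      unfolding verts_elimination_graph later_vertices_def by (rule card_image_le) simp
    finally show ?thesis by simp
  qed
  then have "\<exists>d. \<forall>i < card (verts G). \<forall>x \<in> verts (?H i). degree (?H i) x \<le> d"
    by blast
  from LeastI_ex[OF this] show ?thesis
    using i x unfolding decomposition_width_def by blast
qed

lemma parent_later:
  assumes dec: "tww_decomposition G T prec" and v: "enumerates v (verts G) prec"
    and i: "i \<in> {1..<card (verts G)}"
  shows "parent T (v i) \<in> v ` {i + 1..card (verts G)}"
proof -
  let ?n = "card (verts G)"
  have bij: "bij_betw v {1..?n} (verts G)"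
    and mono: "\<And>i j. i \<in> {1..?n} \<Longrightarrow> j \<in> {1..?n} \<Longrightarrow> (v i, v j) \<in> prec \<longleftrightarrow> i < j"
    using v unfolding enumerates_def by blast+
  have later: "parent T (v j) \<in> v ` {j + 1..?n}" if j: "j \<in> {1..?n}" "v j \<noteq> root T" for j
  proof -
    have "v j \<in> nodes T - {root T}"
      using j bij bij_betwE dec unfolding tww_decomposition_def by blast
    then have "(v j, parent T (v j)) \<in> prec" "parent T (v j) \<in> verts G"
      using dec unfolding tww_decomposition_def is_parent_def rooted_tree_def by blast+
    moreover from this obtain k where k: "k \<in> {1..?n}" "parent T (v j) = v k"
      using bij unfolding bij_betw_def by blast
    ultimately have "j < k" using mono j by metis
    then show ?thesis using k by auto
  qed
  \<comment> \<open>A non-root in the last position would have its parent in the empty range beyond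
    \<open>?n\<close>; so the root is last, and injectivity makes every earlier vertex a
    non-root.\<close>
  have "v ?n = root T"
    using later[of ?n] i by (cases "v ?n = root T") auto
  moreover have "v ?n \<noteq> v i"
    using bij i unfolding bij_betw_def by (auto dest: inj_onD)
  ultimately show ?thesis using later[of i] i by auto
qed

text \<open>Each step contracts the next eliminated vertex with its parent and keeps the parent's
  name. Every vertex is then its own representative, and the red graphs are the
  \<open>H_i\<close>.\<close>

lemma d_sequence_of_decomposition:
  assumes G: "finite_simple_graph G" "verts G \<noteq> {}" and dec: "tww_decomposition G T prec"
  shows "\<exists>S. d_sequence (decomposition_width G T prec) G S"
proof -
  let ?n = "card (verts G)" and ?H = "elimination_graph G T prec"
  have fin: "finite (verts G)"
    using G unfolding finite_simple_graph_def by blast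
  then have n: "?n > 0"
    using G(2) by (simp add: card_gt_0_iff)
  obtain v where v: "enumerates v (verts G) prec"
    using obtain_enumerates[OF fin] dec unfolding tww_decomposition_def by blast
  have bij: "bij_betw v {1..?n} (verts G)"
    using v unfolding enumerates_def by blast
  define S where "S = rec_nat (trigraph_of G)
    (\<lambda>i H. contract H (v (Suc i)) (parent T (v (Suc i))) (parent T (v (Suc i))))"
  have S0: "S 0 = trigraph_of G"
    and SSuc: "S (Suc i) = contract (S i) (v (Suc i)) (parent T (v (Suc i))) (parent T (v (Suc i)))" for i
    unfolding S_def by simp_all
  have rep_Suc: "represents (edges G) (S (Suc i)) id (verts (?H (Suc i))) (edges (?H (Suc i)))
      \<and> contraction (S i) (S (Suc i))"
    if rep: "represents (edges G) (S i) id (verts (?H i)) (edges (?H i))" and i: "Suc i < ?n" for i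
  proof -
    let ?v = "v (Suc i)" and ?p = "parent T (v (Suc i))"
    have tv: "tverts (S i) = v ` {i + 1..?n}"
      using rep later_vertices_enumerates[OF v] unfolding represents_def bij_betw_def
      by (simp add: verts_elimination_graph)
    have p: "?p \<in> v ` {Suc i + 1..?n}"
      using parent_later[OF dec v, of "Suc i"] i by simp
    have mem: "?v \<in> tverts (S i)" "?p \<in> tverts (S i)"
      using p i unfolding tv by auto
    have neq: "?v \<noteq> ?p"
    proof -
      obtain k where k: "k \<in> {Suc i + 1..?n}" "?p = v k"
        using p by blast
      then have "v k \<noteq> v (Suc i)"
        using bij i inj_onD[of v "{1..?n}" k "Suc i"] unfolding bij_betw_def by auto
      then show ?thesis using k by simp
    qed
    have later: "later_vertices (verts G) prec (Suc i) = later_vertices (verts G) prec i - {?v}"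
      using later_vertices_Suc[OF v] i by simp
    have nth: "nth_vertex (verts G) prec (Suc i) = ?v"
      using nth_vertex_enumerates[OF v] i by simp
    \<comment> \<open>The contraction has just freed the name \<open>?p\<close>, so it may be
      reused. The updated map \<open>id(?p := id ?p)\<close> is again \<open>id\<close>.\<close>
    have "?p \<notin> tverts (S i) - {?v, ?p}"
      by blast
    from represents_contract[OF rep mem neq this]
    have "represents (edges G) (S (Suc i)) id (verts (?H (Suc i))) (edges (?H (Suc i)))"
      unfolding SSuc edges_elimination_graph_Suc verts_elimination_graph nth later
      by (simp add: fun_upd_idem)
    moreover have "contraction (S i) (S (Suc i))"
      unfolding contraction_def SSuc using mem neq by blast
    ultimately show ?thesis by blast
  qed
  have rep: "represents (edges G) (S i) id (verts (?H i)) (edges (?H i))" if "i < ?n" for i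
    using that
  proof (induction i)
    case 0
    have "later_vertices (verts G) prec 0 = verts G"
      using bij later_vertices_enumerates[OF v] unfolding bij_betw_def by simp
    then show ?case
      using represents_trigraph_of[OF G(1)] S0 by (simp add: id_def)
  next
    case (Suc i)
    then show ?case using rep_Suc Suc_lessD by blast
  qed
  have "d_trigraph (decomposition_width G T prec) (S i)" if "i < ?n" for i
    using represents_d_trigraph[OF rep[OF that]] degree_le_decomposition_width[OF that]
    by (simp add: degree_def)
  moreover have "contraction (S (i - 1)) (S i)" if "i \<in> {1..<?n}" for i
    using rep_Suc[of "i - 1"] rep[of "i - 1"] that by auto
  moreover have "card (tverts (S (?n - 1))) = 1"
  proof -
    have "tverts (S (?n - 1)) = v ` {?n - 1 + 1..?n}"
      using rep[of "?n - 1"] n later_vertices_enumerates[OF v, of "?n - 1"]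
      unfolding represents_def bij_betw_def by (simp add: verts_elimination_graph)
    then show ?thesis using n by simp
  qed
  ultimately show ?thesis
    unfolding d_sequence_def using S0 by blast
qed

subsection \<open>From contraction sequences to decompositions\<close>

text \<open>Parents placed later in the enumeration form a tree rooted at the last vertex, because
  climbing increases the position. Each climb also increases in \<open>lt\<close>, so transitivity
  makes the root the \<open>lt\<close>-maximum.\<close>

lemma decomposition_of_enumeration:
  assumes fin: "finite V" "V \<noteq> {}" and lt: "linear_ordering_of V lt"
    and bij: "bij_betw v {1..card V} V"
    and p: "\<And>i. i \<in> {1..<card V} \<Longrightarrow> p i \<in> v ` {i + 1..card V} \<and> (v i, p i) \<in> lt"
  obtains T prec where "enumerates v V prec" "linear_ordering_of V prec"
    "rooted_tree T" "nodes T = V" "\<forall>x y. is_parent T x y \<longrightarrow> (y, x) \<in> lt \<inter> prec"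
    "\<forall>x \<in> V - {root T}. (x, root T) \<in> lt"
    "\<And>i. i \<in> {1..<card V} \<Longrightarrow> parent T (v i) = p i"
proof -
  let ?n = "card V"
  define prec where "prec = {(v i, v j) | i j. i \<in> {1..?n} \<and> j \<in> {1..?n} \<and> i < j}"
  \<comment> \<open>\<open>inv_into\<close> recovers the position of a vertex, at which
    \<open>p\<close> is then evaluated.\<close>
  define T where "T = \<lparr>nodes = V, root = v ?n, parent = p \<circ> inv_into {1..?n} v\<rparr>"
  have en: "enumerates v V prec" and lin: "linear_ordering_of V prec"
    using enumerates_linear_ordering[OF bij] unfolding prec_def by blast+
  have n: "?n \<ge> 1"
    using fin by (simp add: Suc_le_eq card_gt_0_iff)
  have inj: "inj_on v {1..?n}"
    using bij unfolding bij_betw_def by blast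
  have par: "parent T (v i) = p i" if "i \<in> {1..<?n}" for i
    using that inj unfolding T_def by simp
  have inner: "\<exists>i\<in>{1..<?n}. y = v i" if y: "y \<in> V - {root T}" for y
  proof -
    obtain i where i: "i \<in> {1..?n}" "y = v i"
      using y bij unfolding bij_betw_def by blast
    moreover have "i \<noteq> ?n"
      using i y unfolding T_def by auto
    ultimately show ?thesis by auto
  qed
  have is_par: "is_parent T x (v i) \<longleftrightarrow> x = p i" if i: "i \<in> {1..<?n}" for x i
  proof -
    have "v i \<noteq> v ?n"
      using inj_onD[OF inj, of i ?n] i by auto
    moreover have "v i \<in> V"
      using bij_betwE[OF bij] i by auto
    ultimately show ?thesis
      unfolding is_parent_def par[OF i] by (simp add: T_def)
  qed
  have tr: "trans lt"
    using lt unfolding linear_ordering_of_def strict_linear_order_on_def by blast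
  have reach: "(v i, root T) \<in> {(z, x). is_parent T x z}\<^sup>* \<and> (v i = root T \<or> (v i, root T) \<in> lt)"
    if "i \<in> {1..?n}" for i
    using that
  \<comment> \<open>Induction on the distance to the last position; the parent lies strictly closer
    to it.\<close>
  proof (induction "?n - i" arbitrary: i rule: less_induct)
    case less
    show ?case
    proof (cases "i = ?n")
      case True
      then show ?thesis unfolding T_def by simp
    next
      case False
      then have i: "i \<in> {1..<?n}" using less.prems by auto
      then obtain j where j: "j \<in> {i + 1..?n}" "p i = v j"
        using p by blast
      then have "(v j, root T) \<in> {(z, x). is_parent T x z}\<^sup>* \<and>
          (v j = root T \<or> (v j, root T) \<in> lt)"
        using less.hyps[of j] i by auto
      moreover have "is_parent T (v j) (v i)"
        using is_par[OF i] j by simp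
      moreover have "(v i, v j) \<in> lt"
        using p[OF i] j by simp
      ultimately show ?thesis
        using tr by (auto intro: converse_rtrancl_into_rtrancl dest: transD)
    qed
  qed
  have pV: "p i \<in> V" if "i \<in> {1..<?n}" for i
    using p[OF that] bij_betwE[OF bij] that by auto
  have "rooted_tree T"
    unfolding rooted_tree_def
  proof (intro conjI ballI)
    show "root T \<in> nodes T"
      unfolding T_def using bij_betwE[OF bij] n by simp
    show "parent T y \<in> nodes T" if y: "y \<in> nodes T - {root T}" for y
    proof -
      have "nodes T = V" unfolding T_def by simp
      then show ?thesis using inner[of y] y par pV by auto
    qed
    show "(y, root T) \<in> {(z, x). is_parent T x z}\<^sup>*" if y: "y \<in> nodes T" for y
    proof -
      have "nodes T = V" unfolding T_def by simp
      then obtain i where "i \<in> {1..?n}" "y = v i"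
        using y bij unfolding bij_betw_def by blast
      then show ?thesis using reach by blast
    qed
  qed
  moreover have "(y, x) \<in> lt \<inter> prec" if xy: "is_parent T x y" for x y
  proof -
    have "y \<in> V - {root T}"
      using xy unfolding is_parent_def T_def by simp
    then obtain i where i: "i \<in> {1..<?n}" "y = v i"
      using inner by blast
    then have x: "x = p i" using is_par xy by blast
    moreover obtain j where "j \<in> {i + 1..?n}" "p i = v j"
      using p i by blast
    ultimately have "(y, x) \<in> prec"
      unfolding prec_def using i by (intro CollectI exI[of _ i] exI[of _ j]) auto
    then show ?thesis using p i x by blast
  qed
  moreover have "(x, root T) \<in> lt" if x: "x \<in> V - {root T}" for x
  proof -
    obtain i where "i \<in> {1..<?n}" "x = v i"
      using inner[OF x] by blast
    then show ?thesis using reach[of i] x by auto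
  qed
  moreover have "nodes T = V" unfolding T_def by simp
  ultimately show ?thesis using that en lin par by blast
qed

text \<open>Guarantees that the minimum defining \<open>tww\<close> is attained. The witness is a
  star: every other vertex has the \<open>lt\<close>-maximum as parent, and the elimination follows
  \<open>lt\<close>.\<close>

lemma exists_d_sequence:
  assumes G: "finite_simple_graph G" "verts G \<noteq> {}" and lt: "linear_ordering_of (verts G) lt"
  shows "\<exists>d S. d_sequence d G S"
proof -
  let ?n = "card (verts G)"
  have fin: "finite (verts G)"
    using G unfolding finite_simple_graph_def by blast
  obtain v where v: "enumerates v (verts G) lt"
    using obtain_enumerates[OF fin lt] .
  then have bij: "bij_betw v {1..?n} (verts G)"
    unfolding enumerates_def by blast
  have "v ?n \<in> v ` {i + 1..?n} \<and> (v i, v ?n) \<in> lt" if "i \<in> {1..<?n}" for i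
    using v that unfolding enumerates_def by auto
  then obtain T prec where "linear_ordering_of (verts G) prec" "rooted_tree T" "nodes T = verts G"
    "\<forall>x y. is_parent T x y \<longrightarrow> (y, x) \<in> lt \<inter> prec"
    using decomposition_of_enumeration[OF fin G(2) lt bij, of "\<lambda>_. v ?n"] by metis
  then have "tww_decomposition G T prec"
    unfolding tww_decomposition_def by blast
  then show ?thesis
    using d_sequence_of_decomposition[OF G] by blast
qed

text \<open>Of the two merged representatives the \<open>lt\<close>-smaller one becomes the
  eliminated \<open>q\<close> and the larger one its parent \<open>p\<close>;
  \<open>contract_commute\<close> covers the case where they occur in the opposite order.\<close>

lemma represents_contraction:
  assumes rep: "represents E S f U R" and c: "contraction S S'" and lt: "total_on U lt"
  shows "\<exists>f' q p. q \<in> U \<and> p \<in> U \<and> p \<noteq> q \<and> (q, p) \<in> lt \<and>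
    represents E S' f' (U - {q}) (merge_red E (U - {q}) R q p)"
proof -
  obtain u v w where uv: "u \<in> tverts S" "v \<in> tverts S" "u \<noteq> v"
    and w: "w \<notin> tverts S - {u, v}" and S': "S' = contract S u v w"
    using c unfolding contraction_def by blast
  have f: "bij_betw f (tverts S) U"
    using rep unfolding represents_def by blast
  have fuv: "f u \<in> U" "f v \<in> U" "f u \<noteq> f v"
    using f uv unfolding bij_betw_def by (auto dest: inj_onD)
  then consider "(f u, f v) \<in> lt" | "(f v, f u) \<in> lt"
    using lt unfolding total_on_def by blast
  then show ?thesis
  proof cases
    case 1
    then show ?thesis using represents_contract[OF rep uv w] fuv S' by metis
  next
    case 2
    have "w \<notin> tverts S - {v, u}" using w by blast
    then show ?thesis
      using 2 represents_contract[OF rep uv(2,1) uv(3)[symmetric]] fuv S' contract_commute[of S u v w]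
      by metis
  qed
qed

text \<open>
  The state \<open>(f, U, R)\<close> chosen at time \<open>i\<close> represents \<open>S i\<close>; the vertices eliminated between successive
  states enumerate the elimination ordering. The indices of \<open>q\<close> and \<open>p\<close> are shifted by one, since
  the vertices \<open>v\<^sub>i\<close> are counted from 1.
\<close>

lemma decomposition_of_d_sequence:
  assumes G: "finite_simple_graph G" "verts G \<noteq> {}" and lt: "linear_ordering_of (verts G) lt"
    and S: "d_sequence d G S"
  obtains T prec where "tww_decomposition G T prec" "decomposition_width G T prec \<le> d"
    "\<forall>x y. is_parent T x y \<longrightarrow> (y, x) \<in> lt" "\<forall>x \<in> verts G - {root T}. (x, root T) \<in> lt"
proof -
  let ?V = "verts G" and ?E = "edges G"
  let ?n = "card ?V"
  have fin: "finite ?V"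
    using G unfolding finite_simple_graph_def by blast
  have n: "?n > 0"
    using fin G(2) by (simp add: card_gt_0_iff)
  have tot: "total_on U lt" if "U \<subseteq> ?V" for U
    using lt that unfolding linear_ordering_of_def strict_linear_order_on_def total_on_def by blast
  \<comment> \<open>\<open>P\<close> and \<open>Q\<close> are guarded by bounds on the index, so
    that the choice below can run over all natural numbers although the contraction sequence is
    finite.\<close>
  define P where "P i = (\<lambda>(f, U, R). i < ?n \<longrightarrow> U \<subseteq> ?V \<and> represents ?E (S i) f U R)" for i
  define Q where "Q i = (\<lambda>(f :: 'a \<Rightarrow> 'a, U, R) (f' :: 'a \<Rightarrow> 'a, U', R'). Suc i < ?n \<longrightarrow> (\<exists>q p. q \<in> U \<and> p \<in> U \<and> p \<noteq> q \<and>
      (q, p) \<in> lt \<and> U' = U - {q} \<and> R' = merge_red ?E U' R q p))"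
    for i
  obtain X where XP: "\<And>i. P i (X i)" and XQ: "\<And>i. Q i (X i) (X (Suc i))" and X0: "X 0 = (id, ?V, {})"
  proof -
    \<comment> \<open>The conjunct for \<open>i = 0\<close> is added to the invariant in order to
      fix the initial state.\<close>
    have "\<exists>X. \<forall>i. (P i (X i) \<and> (i = 0 \<longrightarrow> X i = (id, ?V, {}))) \<and> Q i (X i) (X (Suc i))"
    proof (rule dependent_nat_choice)
      show "\<exists>x. P 0 x \<and> (0 = (0::nat) \<longrightarrow> x = (id, ?V, {}))"
        using represents_trigraph_of[OF G(1)] S unfolding P_def d_sequence_def by auto
    next
      fix x i assume x: "P i x \<and> (i = 0 \<longrightarrow> x = (id, ?V, {}))"
      obtain f U R where x_eq: "x = (f, U, R)" by (cases x)
      show "\<exists>y. (P (Suc i) y \<and> (Suc i = 0 \<longrightarrow> y = (id, ?V, {}))) \<and> Q i x y"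
      proof (cases "Suc i < ?n")
        case True
        then have "U \<subseteq> ?V" "represents ?E (S i) f U R"
          using x unfolding x_eq P_def by auto
        moreover have "contraction (S i) (S (Suc i))"
        proof -
          have "\<forall>i \<in> {1..<?n}. contraction (S (i - 1)) (S i)"
            using S unfolding d_sequence_def by blast
          then show ?thesis using True by (auto dest: bspec[of _ _ "Suc i"])
        qed
        ultimately obtain f' q p where "q \<in> U" "p \<in> U" "p \<noteq> q" "(q, p) \<in> lt"
          "represents ?E (S (Suc i)) f' (U - {q}) (merge_red ?E (U - {q}) R q p)"
          using represents_contraction tot by metis
        then show ?thesis
          using \<open>U \<subseteq> ?V\<close> unfolding x_eq P_def Q_def
          by (intro exI[of _ "(f', U - {q}, merge_red ?E (U - {q}) R q p)"]) auto
      next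
        case False
        then show ?thesis unfolding P_def Q_def by auto
      qed
    qed
    then show ?thesis using that by blast
  qed
  define U where "U i = fst (snd (X i))" for i
  define R where "R i = snd (snd (X i))" for i
  have rep: "represents ?E (S i) (fst (X i)) (U i) (R i)" if "i < ?n" for i
    using XP[of i] that unfolding P_def U_def R_def by (auto simp: split_beta)
  have U0: "U 0 = ?V" and R0: "R 0 = {}"
    unfolding U_def R_def X0 by simp_all
  have "\<exists>q p. Suc i < ?n \<longrightarrow> q \<in> U i \<and> p \<in> U i \<and> p \<noteq> q \<and> (q, p) \<in> lt \<and>
      U (Suc i) = U i - {q} \<and> R (Suc i) = merge_red ?E (U (Suc i)) (R i) q p" for i
    using XQ[of i] unfolding Q_def U_def R_def by (simp add: split_beta)
  then obtain q p where step: "\<And>i. Suc i < ?n \<Longrightarrow> q i \<in> U i \<and> p i \<in> U i \<and> p i \<noteq> q i \<and>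
      (q i, p i) \<in> lt \<and> U (Suc i) = U i - {q i} \<and>
      R (Suc i) = merge_red ?E (U (Suc i)) (R i) (q i) (p i)"
    by metis
  have "card (tverts (S (?n - 1))) = 1"
    using S unfolding d_sequence_def by blast
  moreover have "bij_betw (fst (X (?n - 1))) (tverts (S (?n - 1))) (U (?n - 1))"
    using rep[of "?n - 1"] n unfolding represents_def by simp
  ultimately have "card (U (?n - 1)) = 1"
    using bij_betw_same_card by metis
  then obtain r where r: "U (?n - 1) = {r}"
    using card_1_singletonE by blast
  \<comment> \<open>Position \<open>i\<close> is eliminated on passing from state
    \<open>i - 1\<close> to state \<open>i\<close>; the sole survivor \<open>r\<close> takes
    position \<open>?n\<close>.\<close>
  define v where "v i = (if i = ?n then r else q (i - 1))" for i
  \<comment> \<open>Backward induction from the final state \<open>{r}\<close>, restoring one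
    eliminated vertex at a time.\<close>
  have image: "U i = v ` {i + 1..?n}" if "i < ?n" for i
    using that
  proof (induction "?n - i" arbitrary: i)
    case 0
    then show ?case by simp
  next
    case (Suc k)
    show ?case
    proof (cases "Suc i = ?n")
      case True
      then have "i = ?n - 1" by simp
      then have "U i = {r}" using r by blast
      then show ?thesis unfolding v_def using True by simp
    next
      case False
      then have i: "Suc i < ?n" using Suc.prems by simp
      have "k = ?n - Suc i" using Suc.hyps(2) by simp
      then have "U (Suc i) = v ` {Suc i + 1..?n}"
        using Suc.hyps(1) i by blast
      moreover have "U i = insert (v (Suc i)) (U (Suc i))"
        using step[OF i] i unfolding v_def by auto
      moreover have "{i + 1..?n} = insert (Suc i) {Suc i + 1..?n}"
        using i by auto
      ultimately show ?thesis by simp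
    qed
  qed
  have "v ` {1..?n} = ?V"
    using image[of 0] U0 n by simp
  \<comment> \<open>A map from \<open>?n\<close> positions onto a set of \<open>?n\<close> vertices
    is injective.\<close>
  then have bij: "bij_betw v {1..?n} ?V"
    unfolding bij_betw_def by (simp add: eq_card_imp_inj_on)
  define p' where "p' i = p (i - 1)" for i
  \<comment> \<open>\<open>p (i - 1)\<close> lies in \<open>U (i - 1)\<close> and differs from the
    eliminated vertex, so it survives in \<open>U i\<close>.\<close>
  have "p' i \<in> v ` {i + 1..?n} \<and> (v i, p' i) \<in> lt" if "i \<in> {1..<?n}" for i
    using step[of "i - 1"] image[of i] that unfolding v_def p'_def by auto
  then obtain T prec where en: "enumerates v ?V prec" and lin: "linear_ordering_of ?V prec"
    and tree: "rooted_tree T" "nodes T = ?V" and up: "\<forall>x y. is_parent T x y \<longrightarrow> (y, x) \<in> lt \<inter> prec"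
    and root: "\<forall>x \<in> ?V - {root T}. (x, root T) \<in> lt"
    and par: "\<And>i. i \<in> {1..<?n} \<Longrightarrow> parent T (v i) = p' i"
    using decomposition_of_enumeration[OF fin G(2) lt bij, of p'] by metis
  \<comment> \<open>The chosen states and the elimination graphs start without edges and obey the
    same \<open>merge_red\<close> recursion.\<close>
  have H: "elimination_graph G T prec i = \<lparr>verts = U i, edges = R i\<rparr>" if "i < ?n" for i
    using that
  proof (induction i)
    case 0
    then show ?case
      using image[of 0] R0 n later_vertices_enumerates[OF en, of 0] by simp
  next
    case (Suc i)
    have nth: "nth_vertex ?V prec (Suc i) = q i"
      using nth_vertex_enumerates[OF en, of "Suc i"] Suc.prems unfolding v_def by simp
    have "parent T (q i) = p i"
      using par[of "Suc i"] Suc.prems unfolding v_def p'_def by simp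
    moreover have "later_vertices ?V prec (Suc i) = U (Suc i)"
      using later_vertices_enumerates[OF en] image[OF Suc.prems] by simp
    ultimately have "verts (elimination_graph G T prec (Suc i)) = U (Suc i)"
      "edges (elimination_graph G T prec (Suc i)) = R (Suc i)"
      using Suc step[OF Suc.prems]
      unfolding verts_elimination_graph edges_elimination_graph_Suc nth by simp_all
    then show ?case by (intro graph.equality) (simp_all del: elimination_graph.simps)
  qed
  have "degree (elimination_graph G T prec i) x \<le> d"
    if i: "i < ?n" and x: "x \<in> verts (elimination_graph G T prec i)" for i x
  proof -
    have "d_trigraph d (S i)"
      using S i unfolding d_sequence_def by blast
    then show ?thesis
      using represents_d_trigraph[OF rep[OF i]] x unfolding H[OF i] by simp
  qed
  then have "decomposition_width G T prec \<le> d"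
    by (intro decomposition_widthI) blast
  moreover have "tww_decomposition G T prec"
    unfolding tww_decomposition_def using tree lin up by blast
  ultimately show ?thesis using that up root by blast
qed

section \<open>Both translations combined at the minimum\<close>

theorem theorem1:
  fixes G :: "'a graph" and d :: nat and less :: "'a rel"
  assumes "finite_simple_graph G"
    and "verts G \<noteq> {}"
    and "linear_ordering_of (verts G) less"
  shows "tww G \<le> d \<longleftrightarrow>
    (\<exists>T prec. tww_decomposition G T prec
       \<and> decomposition_width G T prec \<le> d
       \<and> (\<forall>x y. is_parent T x y \<longrightarrow> (y, x) \<in> less)
       \<and> (\<forall>v \<in> verts G - {root T}. (v, root T) \<in> less))"
proof
  assume "tww G \<le> d"
  \<comment> \<open>A sequence is taken at the exact value \<open>tww G\<close>, where the minimum
    is attained; the width bound then passes to \<open>d\<close> by transitivity.\<close>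
  moreover obtain S where "d_sequence (tww G) G S"
    using LeastI_ex[OF exists_d_sequence[OF assms]] unfolding tww_def by blast
  ultimately show "\<exists>T prec. tww_decomposition G T prec
       \<and> decomposition_width G T prec \<le> d
       \<and> (\<forall>x y. is_parent T x y \<longrightarrow> (y, x) \<in> less)
       \<and> (\<forall>v \<in> verts G - {root T}. (v, root T) \<in> less)"
    using decomposition_of_d_sequence[OF assms] by (metis order_trans)
next
  assume "\<exists>T prec. tww_decomposition G T prec
       \<and> decomposition_width G T prec \<le> d
       \<and> (\<forall>x y. is_parent T x y \<longrightarrow> (y, x) \<in> less)
       \<and> (\<forall>v \<in> verts G - {root T}. (v, root T) \<in> less)"
  then obtain T prec where "tww_decomposition G T prec" and width: "decomposition_width G T prec \<le> d"
    by blast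
  then have "\<exists>S. d_sequence (decomposition_width G T prec) G S"
    using d_sequence_of_decomposition[OF assms(1,2)] by blast
  then have "tww G \<le> decomposition_width G T prec"
    unfolding tww_def by (rule Least_le)
  then show "tww G \<le> d" using width by simp
qed

end
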